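(* Let $(P,\circ_\lambda,\succ_\lambda)$ be a pre-Poisson conformal algebra. Define $$[a_\lambda b]:=a\circ_\lambda b-b\circ_{-\lambda-\partial}a,\qquad a_\lambda b:=a\succ_\lambda b+b\succ_{-\lambda-\partial}a,\qquad a,b\in P.$$ Then $(P,[\cdot_\lambda\cdot],\cdot_\lambda\cdot)$ is a Poisson conformal algebra (called the associated Poisson conformal algebra of $(P,\circ_\lambda,\succ_\lambda)$). Moreover, $(P,\mathfrak L_\circ,\mathfrak L_\succ)$ is a representation of $(P,[\cdot_\lambda\cdot],\cdot_\lambda\cdot)$ and the identity map $I:P\to P$ is an $\mathcal O$-operator on $(P,[\cdot_\lambda\cdot],\cdot_\lambda\cdot)$ associated with $(P,\mathfrak L_\circ,\mathfrak L_\succ)$, where $\mathfrak L_\circ(a)_\lambda b=a\circ_\lambda b$ and $\mathfrak L_\succ(a)_\lambda b=a\succ_\lambda b$ for all $a,b\in P$.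
   Context: Let $\mathbf k$ be a field of characteristic $0$. All $\mathbf k[\partial]$-modules are assumed finitely generated. A left-symmetric conformal algebra $(P,\circ_\lambda)$ is a $\mathbf k[\partial]$-module $P$ with a $\mathbf k$-bilinear map $\circ_\lambda:P\times P\to P[\lambda]$ such that $(\partial a)\circ_\lambda b=-\lambda a\circ_\lambda b$, $a\circ_\lambda(\partial b)=(\partial+\lambda)a\circ_\lambda b$ and $a\circ_\lambda(b\circ_\mu c)-(a\circ_\lambda b)\circ_{\lambda+\mu}c=b\circ_\mu(a\circ_\lambda c)-(b\circ_\mu a)\circ_{\lambda+\mu}c$. A Zinbiel conformal algebra $(P,\succ_\lambda)$ is a $\mathbf k[\partial]$-module $P$ with a $\mathbf k$-bilinear map $\succ_\lambda:P\times P\to P[\lambda]$ such that $(\partial a)\succ_\lambda b=-\lambda a\succ_\lambda b$, $a\succ_\lambda(\partial b)=(\partial+\lambda)a\succ_\lambda b$ and $a\succ_\lambda(b\succ_\mu c)=(a\succ_\lambda b+b\succ_{-\lambda-\partial}a)\succ_{\lambda+\mu}c$. A pre-Poisson conformal algebra is a triple $(P,\circ_\lambda,\succ_\lambda)$ where $(P,\succ_\lambda)$ is a Zinbiel conformal algebra, $(P,\circ_\lambda)$ is a left-symmetric conformal algebra and $(a\circ_\lambda b-b\circ_{-\lambda-\partial}a)\succ_{\lambda+\mu}c=a\circ_\lambda(b\succ_\mu c)-b\succ_\mu(a\circ_\lambda c)$, $(a\succ_\lambda b+b\succ_{-\lambda-\partial}a)\circ_{\lambda+\mu}c=a\succ_\lambda(b\circ_\mu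 c)+b\succ_\mu(a\circ_\lambda c)$. (Substitution convention: if $b\circ_\nu a=\sum_k\nu^kc_k$ then $b\circ_{-\lambda-\partial}a=\sum_k(-\lambda-\partial)^kc_k$; similarly for other products.) An associative conformal algebra is a $\mathbf k[\partial]$-module $P$ with a $\mathbf k$-bilinear map $P\times P\to P[\lambda]$, $(a,b)\mapsto a_\lambda b$, with $(\partial a)_\lambda b=-\lambda a_\lambda b$, $a_\lambda(\partial b)=(\partial+\lambda)a_\lambda b$, $(a_\lambda b)_{\lambda+\mu}c=a_\lambda(b_\mu c)$; it is commutative if $a_\lambda b=b_{-\lambda-\partial}a$. A Lie conformal algebra is a $\mathbf k[\partial]$-module $P$ with a $\mathbf k$-bilinear map $[\cdot_\lambda\cdot]:P\times P\to P[\lambda]$ with $[(\partial a)_\lambda b]=-\lambda[a_\lambda b]$, $[a_\lambda(\partial b)]=(\partial+\lambda)[a_\lambda b]$, $[a_\lambda b]=-[b_{-\lambda-\partial}a]$, $[a_\lambda[b_\mu c]]=[[a_\lambda b]_{\lambda+\mu}c]+[b_\mu[a_\lambda c]]$. A Poisson conformal algebra is both a Lie conformal algebra and a commutative associative conformal algebra such that $[a_\lambda(b_\mu c)]=[a_\lambda b]_{\lambda+\mu}c+b_\mu[a_\lambda c]$. For a $\mathbf k[\partial]$-module $V$, $\mathrm{gc}(V)$ is the set of $\mathbf k$-linear maps $f_\lambda:V\to V[\lambda]$ with $f_\lambda(\partial v)=(\partial+\lambda)f_\lambda v$, a $\mathbf k[\partial]$-module via $(\partial f)_\lambda=-\lambda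 f_\lambda$. A representation of a Poisson conformal algebra $P$ is a triple $(V,\rho_P,l_P)$ with $\rho_P,l_P:P\to\mathrm{gc}(V)$ $\mathbf k[\partial]$-module homomorphisms such that $\rho_P([a_\lambda b])_{\lambda+\mu}v=\rho_P(a)_\lambda(\rho_P(b)_\mu v)-\rho_P(b)_\mu(\rho_P(a)_\lambda v)$, $l_P(a_\lambda b)_{\lambda+\mu}v=l_P(a)_\lambda(l_P(b)_\mu v)$, $\rho_P(a_\mu b)_{-\lambda-\partial}v=l_P(b)_{-\lambda-\mu-\partial}(\rho_P(a)_{-\lambda-\partial}v)+l_P(a)_\mu(\rho_P(b)_{-\lambda-\partial}v)$ and $\rho_P(a)_\lambda(l_P(b)_\mu v)=l_P([a_\lambda b])_{\lambda+\mu}v+l_P(b)_\mu(\rho_P(a)_\lambda v)$. An $\mathcal O$-operator on $P$ associated with $(V,\rho_P,l_P)$ is a $\mathbf k[\partial]$-module homomorphism $T:V\to P$ with $T(u)_\lambda T(v)=T(l_P(T(u))_\lambda v)+T(l_P(T(v))_{-\lambda-\partial}u)$ and $[T(u)_\lambda T(v)]=T(\rho_P(T(u))_\lambda v)-T(\rho_P(T(v))_{-\lambda-\partial}u)$ for all $u,v\in V$. *)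

theory Defs
  imports Main "HOL-Computational_Algebra.Polynomial"
begin

text \<open>
  A module over \<open>k[\<partial>]\<close> is a scalar multiplication \<open>s\<close> by \<^typ>\<open>'k poly\<close> on a type \<open>'p\<close>; the
  indeterminate of \<^typ>\<open>'k poly\<close> is \<open>\<partial>\<close>, and \<open>k\<close> acts through the constant polynomials.
\<close>

locale fg_module = module s
  for s :: "'k::field_char_0 poly \<Rightarrow> 'p::ab_group_add \<Rightarrow> 'p" +
  assumes finitely_generated: "\<exists>S. finite S \<and> span S = UNIV"

definition partial :: "('k::field_char_0 poly \<Rightarrow> 'p::ab_group_add \<Rightarrow> 'p) \<Rightarrow> 'p \<Rightarrow> 'p" where
  "partial s = s [:0, 1:]"

text \<open>
  \<open>P[\<lambda>]\<close> is \<^typ>\<open>'p poly\<close>: multiplication by \<open>\<lambda>\<close> is \<^term>\<open>pCons 0\<close>, while \<open>\<partial>\<close> and the scalars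
  act on the coefficients.
\<close>

definition k_linear ::
  "('k::field_char_0 poly \<Rightarrow> 'p::ab_group_add \<Rightarrow> 'p) \<Rightarrow> ('k poly \<Rightarrow> 'q::ab_group_add \<Rightarrow> 'q) \<Rightarrow>
   ('p \<Rightarrow> 'q poly) \<Rightarrow> bool" where
  "k_linear s t = Vector_Spaces.linear (\<lambda>c. s [:c:]) (\<lambda>c. map_poly (t [:c:]))"

text \<open>
  \<open>poly_at X h q\<close> is \<open>\<Sum>k X\<^sup>k (h q\<^sub>k)\<close> for \<open>q = \<Sum>k \<nu>\<^sup>k q\<^sub>k\<close>: the indeterminate is replaced by the
  operator \<open>X\<close>, and the coefficients are sent by \<open>h\<close> into the space on which \<open>X\<close> operates.
\<close>

definition poly_at :: "('m::ab_group_add \<Rightarrow> 'm) \<Rightarrow> ('a::zero \<Rightarrow> 'm) \<Rightarrow> 'a poly \<Rightarrow> 'm" where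
  "poly_at X h q = (\<Sum>k\<le>degree q. (X ^^ k) (h (coeff q k)))"

text \<open>\<open>q\<close> with its indeterminate replaced by \<open>- \<lambda> - \<partial>\<close>, as an element of \<open>P[\<lambda>]\<close>.\<close>

definition skew ::
  "('k::field_char_0 poly \<Rightarrow> 'p::ab_group_add \<Rightarrow> 'p) \<Rightarrow> 'p poly \<Rightarrow> 'p poly" where
  "skew s = poly_at (\<lambda>w. - pCons 0 w - map_poly (partial s) w) (\<lambda>x. [:x:])"

text \<open>
  \<open>P[\<lambda>,\<mu>]\<close> is \<^typ>\<open>'p poly poly\<close>, where \<open>\<lambda>\<close> is the inner and \<open>\<mu>\<close> the outer indeterminate. The next
  definitions are operators on this space, to be substituted for the indeterminate of a
  one-variable polynomial.
\<close>

definition Lam :: "'p::ab_group_add poly poly \<Rightarrow> 'p poly poly" where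
  "Lam = map_poly (pCons 0)"

definition Mu :: "'p::ab_group_add poly poly \<Rightarrow> 'p poly poly" where
  "Mu = pCons 0"

definition LamMu :: "'p::ab_group_add poly poly \<Rightarrow> 'p poly poly" where
  "LamMu w = Lam w + Mu w"

definition Partial2 ::
  "('k::field_char_0 poly \<Rightarrow> 'p::ab_group_add \<Rightarrow> 'p) \<Rightarrow> 'p poly poly \<Rightarrow> 'p poly poly" where
  "Partial2 s = map_poly (map_poly (partial s))"

definition NegLamPartial ::
  "('k::field_char_0 poly \<Rightarrow> 'p::ab_group_add \<Rightarrow> 'p) \<Rightarrow> 'p poly poly \<Rightarrow> 'p poly poly" where
  "NegLamPartial s w = - Lam w - Partial2 s w"

definition NegLamMuPartial ::
  "('k::field_char_0 poly \<Rightarrow> 'p::ab_group_add \<Rightarrow> 'p) \<Rightarrow> 'p poly poly \<Rightarrow> 'p poly poly" where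
  "NegLamMuPartial s w = - Lam w - Mu w - Partial2 s w"

definition at2 :: "('p::ab_group_add poly poly \<Rightarrow> 'p poly poly) \<Rightarrow> 'p poly \<Rightarrow> 'p poly poly" where
  "at2 X = poly_at X (\<lambda>x. [:[:x:]:])"

text \<open>
  For \<open>f\<^sub>\<nu> : P \<rightarrow> Q[\<nu>]\<close> and \<open>w = \<Sum>i j \<lambda>\<^sup>i \<mu>\<^sup>j w\<^sub>i\<^sub>j\<close> in \<open>P[\<lambda>,\<mu>]\<close>, \<open>ext2 X f w\<close> is
  \<open>\<Sum>i j \<lambda>\<^sup>i \<mu>\<^sup>j f\<^sub>X(w\<^sub>i\<^sub>j)\<close>. Thus \<open>a\<^sub>\<lambda>(b\<^sub>\<mu> c)\<close> is \<open>ext2 Lam (m a) (at2 Mu (m b c))\<close> and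
  \<open>(a\<^sub>\<lambda> b)\<close> multiplied at \<open>\<lambda> + \<mu>\<close> with \<open>c\<close> is \<open>ext2 LamMu (\<lambda>x. m x c) (at2 Lam (m a b))\<close>. A \<open>\<partial>\<close>
  inside \<open>X\<close> acts on the value of \<open>f\<close>, a \<open>\<partial>\<close> used in forming \<open>w\<close> acts before \<open>f\<close>.
\<close>

definition ext2 ::
  "('q::ab_group_add poly poly \<Rightarrow> 'q poly poly) \<Rightarrow> ('p::ab_group_add \<Rightarrow> 'q poly) \<Rightarrow>
   'p poly poly \<Rightarrow> 'q poly poly" where
  "ext2 X f = poly_at Mu (poly_at Lam (\<lambda>x. at2 X (f x)))"

locale conformal_product = fg_module s
  for s :: "'k::field_char_0 poly \<Rightarrow> 'p::ab_group_add \<Rightarrow> 'p" +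
  fixes m :: "'p \<Rightarrow> 'p \<Rightarrow> 'p poly"
  assumes linear_left: "k_linear s s (\<lambda>a. m a b)"
    and linear_right: "k_linear s s (m a)"
    and partial_left: "m (partial s a) b = - pCons 0 (m a b)"
    and partial_right: "m a (partial s b) = map_poly (partial s) (m a b) + pCons 0 (m a b)"

locale left_symmetric_conformal_algebra = conformal_product s m
  for s :: "'k::field_char_0 poly \<Rightarrow> 'p::ab_group_add \<Rightarrow> 'p" and m +
  assumes left_symmetric:
    "ext2 Lam (m a) (at2 Mu (m b c)) - ext2 LamMu (\<lambda>x. m x c) (at2 Lam (m a b)) =
     ext2 Mu (m b) (at2 Lam (m a c)) - ext2 LamMu (\<lambda>x. m x c) (at2 Mu (m b a))"

locale zinbiel_conformal_algebra = conformal_product s m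
  for s :: "'k::field_char_0 poly \<Rightarrow> 'p::ab_group_add \<Rightarrow> 'p" and m +
  assumes zinbiel:
    "ext2 Lam (m a) (at2 Mu (m b c)) =
     ext2 LamMu (\<lambda>x. m x c) (at2 Lam (m a b + skew s (m b a)))"

locale pre_poisson_conformal_algebra =
  left_symmetric_conformal_algebra s circ + zinbiel_conformal_algebra s succ
  for s :: "'k::field_char_0 poly \<Rightarrow> 'p::ab_group_add \<Rightarrow> 'p" and circ succ +
  assumes circ_succ:
    "ext2 LamMu (\<lambda>x. succ x c) (at2 Lam (circ a b - skew s (circ b a))) =
     ext2 Lam (circ a) (at2 Mu (succ b c)) - ext2 Mu (succ b) (at2 Lam (circ a c))"
    and succ_circ:
    "ext2 LamMu (\<lambda>x. circ x c) (at2 Lam (succ a b + skew s (succ b a))) =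
     ext2 Lam (succ a) (at2 Mu (circ b c)) + ext2 Mu (succ b) (at2 Lam (circ a c))"

locale associative_conformal_algebra = conformal_product s m
  for s :: "'k::field_char_0 poly \<Rightarrow> 'p::ab_group_add \<Rightarrow> 'p" and m +
  assumes associative:
    "ext2 LamMu (\<lambda>x. m x c) (at2 Lam (m a b)) = ext2 Lam (m a) (at2 Mu (m b c))"

locale commutative_associative_conformal_algebra = associative_conformal_algebra s m
  for s :: "'k::field_char_0 poly \<Rightarrow> 'p::ab_group_add \<Rightarrow> 'p" and m +
  assumes commutative: "m a b = skew s (m b a)"

locale lie_conformal_algebra = conformal_product s br
  for s :: "'k::field_char_0 poly \<Rightarrow> 'p::ab_group_add \<Rightarrow> 'p" and br +
  assumes skew_symmetric: "br a b = - skew s (br b a)"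
    and jacobi:
    "ext2 Lam (br a) (at2 Mu (br b c)) =
     ext2 LamMu (\<lambda>x. br x c) (at2 Lam (br a b)) + ext2 Mu (br b) (at2 Lam (br a c))"

locale poisson_conformal_algebra =
  lie_conformal_algebra s br + commutative_associative_conformal_algebra s m
  for s :: "'k::field_char_0 poly \<Rightarrow> 'p::ab_group_add \<Rightarrow> 'p" and br m +
  assumes leibniz:
    "ext2 Lam (br a) (at2 Mu (m b c)) =
     ext2 LamMu (\<lambda>x. m x c) (at2 Lam (br a b)) + ext2 Mu (m b) (at2 Lam (br a c))"

definition gc ::
  "('k::field_char_0 poly \<Rightarrow> 'v::ab_group_add \<Rightarrow> 'v) \<Rightarrow> ('v \<Rightarrow> 'v poly) set" where
  "gc t = {f. k_linear t t f \<and>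
     (\<forall>v. f (partial t v) = map_poly (partial t) (f v) + pCons 0 (f v))}"

text \<open>The \<open>k[\<partial>]\<close>-action on \<open>gc(V)\<close> with \<open>\<partial> f = - \<lambda> f\<close>, that is \<open>p(\<partial>) f = p(- \<lambda>) f\<close>.\<close>

definition gc_scale ::
  "('k::field_char_0 poly \<Rightarrow> 'v::ab_group_add \<Rightarrow> 'v) \<Rightarrow>
   'k poly \<Rightarrow> ('v \<Rightarrow> 'v poly) \<Rightarrow> 'v \<Rightarrow> 'v poly" where
  "gc_scale t p f v = poly_at (\<lambda>w. - pCons 0 w) (\<lambda>c. map_poly (t [:c:]) (f v)) p"

definition gc_hom ::
  "('k::field_char_0 poly \<Rightarrow> 'p::ab_group_add \<Rightarrow> 'p) \<Rightarrow> ('k poly \<Rightarrow> 'v::ab_group_add \<Rightarrow> 'v) \<Rightarrow>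
   ('p \<Rightarrow> 'v \<Rightarrow> 'v poly) \<Rightarrow> bool" where
  "gc_hom s t \<rho> \<longleftrightarrow> (\<forall>a. \<rho> a \<in> gc t) \<and> (\<forall>a b. \<rho> (a + b) = (\<lambda>v. \<rho> a v + \<rho> b v)) \<and>
     (\<forall>p a. \<rho> (s p a) = gc_scale t p (\<rho> a))"

locale poisson_conformal_representation =
  poisson_conformal_algebra s br m + V: fg_module t
  for s :: "'k::field_char_0 poly \<Rightarrow> 'p::ab_group_add \<Rightarrow> 'p" and br m
    and t :: "'k poly \<Rightarrow> 'v::ab_group_add \<Rightarrow> 'v" +
  fixes \<rho> l :: "'p \<Rightarrow> 'v \<Rightarrow> 'v poly"
  assumes rho_hom: "gc_hom s t \<rho>"
    and l_hom: "gc_hom s t l"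
    and rho_bracket:
    "ext2 LamMu (\<lambda>x. \<rho> x v) (at2 Lam (br a b)) =
     ext2 Lam (\<rho> a) (at2 Mu (\<rho> b v)) - ext2 Mu (\<rho> b) (at2 Lam (\<rho> a v))"
    and l_product:
    "ext2 LamMu (\<lambda>x. l x v) (at2 Lam (m a b)) = ext2 Lam (l a) (at2 Mu (l b v))"
    and rho_product:
    "ext2 (NegLamPartial t) (\<lambda>x. \<rho> x v) (at2 Mu (m a b)) =
     ext2 (NegLamMuPartial t) (l b) (at2 (NegLamPartial t) (\<rho> a v)) +
     ext2 Mu (l a) (at2 (NegLamPartial t) (\<rho> b v))"
    and rho_l:
    "ext2 Lam (\<rho> a) (at2 Mu (l b v)) =
     ext2 LamMu (\<lambda>x. l x v) (at2 Lam (br a b)) + ext2 Mu (l b) (at2 Lam (\<rho> a v))"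

locale O_operator = poisson_conformal_representation s br m t \<rho> l
  for s :: "'k::field_char_0 poly \<Rightarrow> 'p::ab_group_add \<Rightarrow> 'p" and br m
    and t :: "'k poly \<Rightarrow> 'v::ab_group_add \<Rightarrow> 'v" and \<rho> l +
  fixes T :: "'v \<Rightarrow> 'p"
  assumes T_hom: "module_hom t s T"
    and T_product:
    "m (T u) (T v) = map_poly T (l (T u) v) + map_poly T (skew t (l (T v) u))"
    and T_bracket:
    "br (T u) (T v) = map_poly T (\<rho> (T u) v) - map_poly T (skew t (\<rho> (T v) u))"

definition conformal_commutator ::
  "('k::field_char_0 poly \<Rightarrow> 'p::ab_group_add \<Rightarrow> 'p) \<Rightarrow> ('p \<Rightarrow> 'p \<Rightarrow> 'p poly) \<Rightarrow>
   'p \<Rightarrow> 'p \<Rightarrow> 'p poly" where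
  "conformal_commutator s circ a b = circ a b - skew s (circ b a)"

definition conformal_anticommutator ::
  "('k::field_char_0 poly \<Rightarrow> 'p::ab_group_add \<Rightarrow> 'p) \<Rightarrow> ('p \<Rightarrow> 'p \<Rightarrow> 'p poly) \<Rightarrow>
   'p \<Rightarrow> 'p \<Rightarrow> 'p poly" where
  "conformal_anticommutator s succ a b = succ a b + skew s (succ b a)"

definition left_mult :: "('p \<Rightarrow> 'p \<Rightarrow> 'p::zero poly) \<Rightarrow> 'p \<Rightarrow> ('p \<Rightarrow> 'p poly)" where
  "left_mult m a = (\<lambda>b. m a b)"

end

theory Submission imports Defs
begin

text \<open>
  Without the parameters the statement is an easy computation with pre-Poisson algebras: every
  required identity is a signed sum of instances of the four axioms. The conformal version is the
  same computation once the parameters are treated symmetrically. Put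
  \<open>\<zeta> = - \<lambda> - \<mu> - \<partial>\<close>, so that \<open>\<lambda> + \<mu> + \<zeta> = - \<partial>\<close>. Sesquilinearity moves every \<open>\<partial>\<close> outside the
  products, and then each substitution \<open>\<nu> := - \<lambda> - \<partial>\<close> in the definitions of \<open>[\<cdot>\<^sub>\<lambda>\<cdot>]\<close> and \<open>\<cdot>\<^sub>\<lambda>\<cdot>\<close> just
  replaces the parameter of one factor: for example
  \<open>a\<^sub>\<lambda>(c \<circ>\<^sub>-\<^sub>\<mu>\<^sub>-\<^sub>\<partial> b)\<close> becomes \<open>a\<^sub>\<lambda>(c\<^sub>\<zeta> b)\<close>, and \<open>(b\<^sub>-\<^sub>\<lambda>\<^sub>-\<^sub>\<partial> a)\<^sub>\<lambda>\<^sub>+\<^sub>\<mu> c\<close> becomes \<open>(b\<^sub>\<mu> a)\<^sub>\<lambda>\<^sub>+\<^sub>\<mu> c\<close>. The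
  effect is that \<open>a\<close> always carries \<open>\<lambda>\<close>, \<open>b\<close> carries \<open>\<mu>\<close>, \<open>c\<close> carries \<open>\<zeta>\<close>, and a bracketed
  pair carries the sum of its two parameters. This rewriting is the content of the lemmas
  \<open>nested_at_skew_outer\<close>, \<open>nested_at_skew_left\<close> and \<open>nested_at_skew_right\<close>.

  The axioms are identities of polynomials in \<open>\<lambda>\<close> and \<open>\<mu>\<close>. Once they are free of \<open>\<partial>\<close>, any two
  commuting operators may be substituted for the indeterminates, so the axioms hold for each pair
  among \<open>\<lambda>, \<mu>, \<zeta>\<close> (\<open>left_symmetric_at\<close>, \<open>zinbiel_at\<close>, \<open>circ_succ_at\<close>, \<open>succ_circ_at\<close>). After that
  only additions and cancellations remain. For example, the Jacobi identity for \<open>a, b, c\<close> is the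
  sum of left symmetry at the pairs \<open>(\<lambda>, \<mu>)\<close>, \<open>(\<lambda>, \<zeta>)\<close> and \<open>(\<mu>, \<zeta>)\<close>, up to signs.
\<close>

section \<open>Substituting an operator for an indeterminate\<close>

lemma funpow_intertwine:
  assumes "\<And>x. E (X x) = Y (E x)"
  shows "E ((X ^^ n) x) = (Y ^^ n) (E x)"
  by (induction n) (simp_all add: assms)

text \<open>
  This is the way in which all operators are moved through substitutions below: \<open>E\<close> may add its own
  contribution to the substituted operator \<open>X\<close>, turning it into \<open>Y\<close>.
\<close>

lemma poly_at_intertwine:
  assumes "additive E" and "\<And>x. E (X x) = Y (E x)"
  shows "E (poly_at X h q) = poly_at Y (\<lambda>x. E (h x)) q"
proof -
  interpret additive E by fact
  show ?thesis
    by (simp add: poly_at_def sum funpow_intertwine[of E X Y] assms(2))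
qed

lemma additive_funpow:
  fixes X :: "'a::ab_group_add \<Rightarrow> 'a"
  assumes "additive X"
  shows "additive (X ^^ n)"
  by (induction n) (use assms in \<open>simp_all add: additive_def\<close>)

text \<open>
  The truncation at the degree in \<open>poly_at\<close> is what obstructs additivity; for additive
  data the sum may be extended to a common bound.
\<close>

lemma poly_at_upto:
  assumes "additive X" "additive h" "degree q \<le> n"
  shows "poly_at X h q = (\<Sum>k\<le>n. (X ^^ k) (h (coeff q k)))"
  unfolding poly_at_def
  by (rule sum.mono_neutral_left)
     (use assms in \<open>auto simp: coeff_eq_0 additive.zero additive_funpow\<close>)

lemma additive_poly_at:
  fixes X :: "'a::ab_group_add \<Rightarrow> 'a" and h :: "'b::ab_group_add \<Rightarrow> 'a"
  assumes "additive X" "additive h"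
  shows "additive (poly_at X h)"
proof
  fix p q :: "'b poly"
  let ?n = "max (degree p) (degree q)"
  have "poly_at X h (p + q) = (\<Sum>k\<le>?n. (X ^^ k) (h (coeff (p + q) k)))"
    by (rule poly_at_upto) (use assms degree_add_le_max in auto)
  then show "poly_at X h (p + q) = poly_at X h p + poly_at X h q"
    using poly_at_upto[OF assms, of p ?n] poly_at_upto[OF assms, of q ?n]
    by (simp add: additive.add[OF assms(2)] additive.add[OF additive_funpow[OF assms(1)]]
        sum.distrib)
qed

lemma poly_at_0: "additive h \<Longrightarrow> poly_at X h 0 = 0"
  by (simp add: poly_at_def additive.zero)

lemma poly_at_pCons:
  assumes "additive X" "additive h"
  shows "poly_at X h (pCons a q) = h a + X (poly_at X h q)"
proof -
  have "poly_at X h (pCons a q)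
      = (\<Sum>k\<le>Suc (degree q). (X ^^ k) (h (coeff (pCons a q) k)))"
    by (rule poly_at_upto[OF assms]) (simp add: degree_pCons_le)
  also have "\<dots> = h a + (\<Sum>k\<le>degree q. X ((X ^^ k) (h (coeff q k))))"
    by (simp add: sum.atMost_Suc_shift del: sum.atMost_Suc)
  finally show ?thesis
    by (simp add: poly_at_def additive.sum[OF assms(1)])
qed

lemma poly_at_const: "additive h \<Longrightarrow> poly_at X h [:a:] = h a"
  by (simp add: poly_at_def)

lemma poly_at_map_poly:
  assumes "additive X" "additive h" "additive g"
  shows "poly_at X h (map_poly g q) = poly_at X (\<lambda>x. h (g x)) q"
proof -
  have hg: "additive (\<lambda>x. h (g x))"
    using assms(2,3) by (simp add: additive_def)
  show ?thesis
    by (induction q)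
       (simp_all add: poly_at_0 poly_at_pCons assms hg map_poly_pCons additive.zero[OF assms(3)])
qed

lemma poly_at_add_fun:
  assumes "additive X"
  shows "poly_at X (\<lambda>x. h x + g x) q = poly_at X h q + poly_at X g q"
  by (simp add: poly_at_def additive.add[OF additive_funpow[OF assms]] sum.distrib)

lemma poly_at_uminus_fun:
  assumes "additive X"
  shows "poly_at X (\<lambda>x. - h x) q = - poly_at X h q"
  by (simp add: poly_at_def additive.minus[OF additive_funpow[OF assms]] sum_negf)

lemma additive_map_poly:
  assumes "additive g"
  shows "additive (map_poly g)"
  by unfold_locales
     (simp add: poly_eq_iff coeff_map_poly additive.zero[OF assms] additive.add[OF assms])

lemma additive_pCons_0: "additive (pCons 0)"
  by unfold_locales simp

lemma map_poly_commute:
  assumes "additive g" "additive h" "\<And>x. g (h x) = h (g x)"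
  shows "map_poly g (map_poly h q) = map_poly h (map_poly g q)"
  by (simp add: poly_eq_iff coeff_map_poly additive.zero[OF assms(1)] additive.zero[OF assms(2)] assms(3))

section \<open>Nested products\<close>

text \<open>
  For \<open>q = b\<^sub>\<nu> c\<close> and \<open>f = a\<^sub>\<nu>\<close>, this is \<open>a\<^sub>X(b\<^sub>Y c)\<close>; for \<open>q = a\<^sub>\<nu> b\<close> and \<open>f\<close> multiplication by \<open>c\<close>
  on the right it is \<open>(a\<^sub>Y b)\<^sub>X c\<close>. In contrast to \<open>ext2 X f (at2 Y q)\<close>, an operator \<open>\<partial>\<close> in
  \<open>Y\<close> acts after \<open>f\<close>, that is, on the result. All identities are brought into this form.
\<close>

definition nested_at ::
  "('q::ab_group_add poly poly \<Rightarrow> 'q poly poly) \<Rightarrow> ('p::zero \<Rightarrow> 'q poly) \<Rightarrow>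
   ('q poly poly \<Rightarrow> 'q poly poly) \<Rightarrow> 'p poly \<Rightarrow> 'q poly poly" where
  "nested_at X f Y q = poly_at Y (\<lambda>x. at2 X (f x)) q"

lemma additive_const2: "additive (\<lambda>x. [:[:x:]:])"
  by unfold_locales simp

lemma additive_at2: "additive X \<Longrightarrow> additive (at2 X)"
  unfolding at2_def by (intro additive_poly_at additive_const2)

lemma additive_comp: "additive f \<Longrightarrow> additive g \<Longrightarrow> additive (\<lambda>x. f (g x))"
  by (simp add: additive_def)

lemma additive_nested_at:
  assumes "additive X" "additive Y" "additive f"
  shows "additive (nested_at X f Y)"
  unfolding nested_at_def
  by (rule additive_poly_at[OF assms(2) additive_comp[OF additive_at2[OF assms(1)] assms(3)]])

lemma Lam_Mu: "Lam (Mu w) = Mu (Lam w)"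
  by (simp add: Lam_def Mu_def map_poly_pCons)

lemma additive_Lam: "additive Lam"
  unfolding Lam_def by (intro additive_map_poly additive_pCons_0)

lemma additive_Mu: "additive Mu"
  unfolding Mu_def by (rule additive_pCons_0)

text \<open>The substitution \<open>\<lambda> := X\<close>, \<open>\<mu> := Y\<close> in \<open>P[\<lambda>,\<mu>]\<close>.\<close>

definition subst2 ::
  "('p::ab_group_add poly poly \<Rightarrow> 'p poly poly) \<Rightarrow> ('p poly poly \<Rightarrow> 'p poly poly) \<Rightarrow>
   'p poly poly \<Rightarrow> 'p poly poly" where
  "subst2 X Y = poly_at Y (poly_at X (\<lambda>x. [:[:x:]:]))"

text \<open>
  Commutation of \<open>X\<close> and \<open>Y\<close> is needed for the formula at \<open>\<lambda>\<close>, since the powers of \<open>Y\<close> are applied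
  outside those of \<open>X\<close>.
\<close>

lemma subst2:
  assumes "additive X" "additive Y" "\<And>w. X (Y w) = Y (X w)"
  shows "additive (subst2 X Y)" 
    and "subst2 X Y (Lam w) = X (subst2 X Y w)"
    and "subst2 X Y (Mu w) = Y (subst2 X Y w)"
    and "subst2 X Y [:[:x:]:] = [:[:x:]:]"
proof -
  have A: "additive (poly_at X (\<lambda>x. [:[:x:]:]))"
    by (intro additive_poly_at additive_const2 assms)
  show "additive (subst2 X Y)"
    unfolding subst2_def by (intro additive_poly_at A assms)
  show "subst2 X Y (Lam w) = X (subst2 X Y w)"
    unfolding subst2_def Lam_def
    by (subst poly_at_intertwine[of X Y Y])
       (simp_all add: poly_at_map_poly assms A additive_pCons_0 poly_at_pCons additive_const2)
  show "subst2 X Y (Mu w) = Y (subst2 X Y w)"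
    by (simp add: subst2_def Mu_def poly_at_pCons A assms additive.zero[OF A])
  show "subst2 X Y [:[:x:]:] = [:[:x:]:]"
    by (simp add: subst2_def poly_at_const A additive_const2)
qed

text \<open>
  An operator that replaces the parameters replaces them in nested products. With \<open>subst2\<close> in the
  place of \<open>E\<close> an identity between nested products at \<open>\<lambda>, \<mu>\<close> yields the same identity at
  other parameters.
\<close>

lemma subst2_nested_at:
  assumes E: "additive E" "\<And>x. E [:[:x:]:] = [:[:x:]:]"
    and "\<And>w. E (U w) = U' (E w)" "\<And>w. E (V w) = V' (E w)"
  shows "E (nested_at U f V q) = nested_at U' f V' q"
  by (simp add: nested_at_def at2_def poly_at_intertwine[of E V V'] poly_at_intertwine[of E U U'] assms)

lemma nested_at_add:
  assumes "additive X" "additive Y" 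
  shows "nested_at X (\<lambda>x. f x + g x) Y q = nested_at X f Y q + nested_at X g Y q"
  by (simp add: nested_at_def additive.add[OF additive_at2] assms poly_at_add_fun)

lemma nested_at_uminus:
  assumes "additive X" "additive Y" 
  shows "nested_at X (\<lambda>x. - f x) Y q = - nested_at X f Y q"
  by (simp add: nested_at_def additive.minus[OF additive_at2] assms poly_at_uminus_fun)

lemma nested_at_diff:
  assumes "additive X" "additive Y" 
  shows "nested_at X (\<lambda>x. f x - g x) Y q = nested_at X f Y q - nested_at X g Y q"
  using nested_at_add[OF assms, of f "\<lambda>x. - g x"] nested_at_uminus[OF assms, of g] by simp

lemma ext2_intertwine:
  assumes X: "additive X" and f: "additive f"
  shows additive_ext2: "additive (ext2 X f)"
    and ext2_Lam: "ext2 X f (Lam w) = Lam (ext2 X f w)"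
    and ext2_Mu: "ext2 X f (Mu w) = Mu (ext2 X f w)"
    and ext2_const: "ext2 X f [:[:x:]:] = at2 X (f x)"
proof -
  have h: "additive (\<lambda>x. at2 X (f x))"
    by (rule additive_comp[OF additive_at2[OF X] f])
  have A: "additive (poly_at Lam (\<lambda>x. at2 X (f x)))"
    by (intro additive_poly_at h additive_Lam)
  show "additive (ext2 X f)"
    unfolding ext2_def by (intro additive_poly_at A additive_Mu)
  show "ext2 X f (Lam w) = Lam (ext2 X f w)"
    using poly_at_intertwine[of Lam Mu Mu "poly_at Lam (\<lambda>x. at2 X (f x))" w, OF additive_Lam Lam_Mu]
      poly_at_map_poly[of Mu "poly_at Lam (\<lambda>x. at2 X (f x))" "pCons 0" w,
        OF additive_Mu A additive_pCons_0]
    by (simp add: ext2_def fun_cong[OF Lam_def, of w] poly_at_pCons[OF additive_Lam h] additive.zero[OF h])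
  show "ext2 X f (Mu w) = Mu (ext2 X f w)"
    by (simp add: ext2_def fun_cong[OF Mu_def, of w] poly_at_pCons A additive_Mu additive.zero[OF A])
  show "ext2 X f [:[:x:]:] = at2 X (f x)"
    by (simp add: ext2_def poly_at_const A h)
qed

text \<open>
  The passage from an iterated extension to a nested product: the substituted \<open>Y\<close> is moved through
  \<open>ext2 X f\<close>. A \<open>\<partial>\<close> contained in \<open>Y\<close> changes on the way, which accounts for \<open>Y'\<close>.
\<close>

lemma ext2_at2:
  assumes "additive X" "additive f" "\<And>w. ext2 X f (Y w) = Y' (ext2 X f w)"
  shows "ext2 X f (at2 Y q) = nested_at X f Y' q"
  unfolding at2_def[of Y] nested_at_def
  by (subst poly_at_intertwine[of "ext2 X f" Y Y'])
     (simp_all add: assms ext2_intertwine)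

lemma ext2_at2_Lam: "additive X \<Longrightarrow> additive f \<Longrightarrow> ext2 X f (at2 Lam q) = nested_at X f Lam q"
  by (rule ext2_at2) (simp_all add: ext2_Lam)

lemma ext2_at2_Mu: "additive X \<Longrightarrow> additive f \<Longrightarrow> ext2 X f (at2 Mu q) = nested_at X f Mu q"
  by (rule ext2_at2) (simp_all add: ext2_Mu)

section \<open>Linear expressions in \<open>\<lambda>\<close>, \<open>\<mu>\<close> and \<open>\<partial>\<close>\<close>

text \<open>
  All substituted operators are linear expressions in \<open>\<lambda>\<close>, \<open>\<mu>\<close> and \<open>\<partial>\<close>. Gathering them in one
  predicate provides their additivity and commutativity at once.
\<close>

inductive parameter ::
  "('k::field_char_0 poly \<Rightarrow> 'p::ab_group_add \<Rightarrow> 'p) \<Rightarrow> ('p poly poly \<Rightarrow> 'p poly poly) \<Rightarrow> bool"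
  for s where
  Lam: "parameter s Lam"
| Mu: "parameter s Mu"
| Partial2: "parameter s (Partial2 s)"
| add: "parameter s X \<Longrightarrow> parameter s Y \<Longrightarrow> parameter s (\<lambda>w. X w + Y w)"
| uminus: "parameter s X \<Longrightarrow> parameter s (\<lambda>w. - X w)"

lemma parameter_LamMu: "parameter s LamMu"
  using parameter.add[OF parameter.Lam parameter.Mu, of s] by (simp add: LamMu_def[abs_def])

lemma parameter_NegLamPartial: "parameter s (NegLamPartial s)"
  using parameter.add[OF parameter.uminus[OF parameter.Lam] parameter.uminus[OF parameter.Partial2], of s]
  by (simp add: NegLamPartial_def[abs_def])

lemma parameter_NegLamMuPartial: "parameter s (NegLamMuPartial s)"
  using parameter.add[OF parameter_NegLamPartial parameter.uminus[OF parameter.Mu], of s]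
  by (simp add: NegLamMuPartial_def[abs_def] NegLamPartial_def algebra_simps)

definition NegMuPartial ::
  "('k::field_char_0 poly \<Rightarrow> 'p::ab_group_add \<Rightarrow> 'p) \<Rightarrow> 'p poly poly \<Rightarrow> 'p poly poly" where
  "NegMuPartial s w = - Mu w - Partial2 s w"

lemma parameter_NegMuPartial: "parameter s (NegMuPartial s)"
  using parameter.add[OF parameter.uminus[OF parameter.Mu] parameter.uminus[OF parameter.Partial2], of s]
  by (simp add: NegMuPartial_def[abs_def])

lemmas parameters = parameter.Lam parameter.Mu parameter_LamMu
  parameter_NegLamPartial parameter_NegMuPartial parameter_NegLamMuPartial

lemmas parameter_defs = LamMu_def NegLamPartial_def NegMuPartial_def NegLamMuPartial_def

context fg_module
begin

lemma additive_scale: "additive (s p)"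
  by unfold_locales (simp add: scale_right_distrib)

lemma additive_partial: "additive (partial s)"
  unfolding partial_def by (rule additive_scale)

lemma additive_Partial2: "additive (Partial2 s)"
  unfolding Partial2_def by (intro additive_map_poly additive_partial)

lemma additive_parameter: "parameter s X \<Longrightarrow> additive X"
proof (induction rule: parameter.induct)
  case (add X Y)
  then show ?case by (simp add: additive_def algebra_simps)
next
  case (uminus X)
  then show ?case by (simp add: additive_def algebra_simps)
qed (rule additive_Lam additive_Mu additive_Partial2)+

lemma parameter_commute:
  assumes "parameter s X" "parameter s Y"
  shows "X (Y w) = Y (X w)"
proof -
  have D: "additive (map_poly (partial s))"
    by (intro additive_map_poly additive_partial)
  have base: "X (Y w) = Y (X w)" 
    if "X \<in> {Lam, Mu, Partial2 s}" "Y \<in> {Lam, Mu, Partial2 s}" for X Y w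
  proof -
    have "Lam (Partial2 s w) = Partial2 s (Lam w)"
      unfolding Lam_def Partial2_def
      by (rule map_poly_commute)
         (simp_all add: additive_pCons_0 D map_poly_pCons additive.zero[OF additive_partial])
    moreover have "Mu (Partial2 s w) = Partial2 s (Mu w)"
      by (simp add: Mu_def Partial2_def map_poly_pCons)
    ultimately show ?thesis
      using that by (auto simp: Lam_Mu)
  qed
  have step: "X (Y w) = Y (X w)"
    if Y: "parameter s Y" and X: "parameter s X" and 
       b: "\<And>Y w. Y \<in> {Lam, Mu, Partial2 s} \<Longrightarrow> X (Y w) = Y (X w)" for X Y w
    using Y
  proof (induction arbitrary: w rule: parameter.induct)
    case (add Y Z)
    then show ?case by (simp add: additive.add[OF additive_parameter[OF X]])
  next
    case (uminus Y)
    then show ?case by (simp add: additive.minus[OF additive_parameter[OF X]])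
  qed (simp_all add: b)
  have gen: "Y (X w) = X (Y w)" if "Y \<in> {Lam, Mu, Partial2 s}" for Y w
    by (rule step[OF assms(1)]) (use that base in \<open>auto intro: parameter.intros\<close>)
  show ?thesis
    by (rule step[OF assms(2,1)]) (simp add: gen)
qed

section \<open>The substitution \<open>\<nu> := - \<lambda> - \<partial>\<close>\<close>

definition neg_lam_partial :: "'p poly \<Rightarrow> 'p poly" where
  "neg_lam_partial w = - pCons 0 w - map_poly (partial s) w"

lemma skew_eq: "skew s = poly_at neg_lam_partial (\<lambda>x. [:x:])"
  unfolding skew_def neg_lam_partial_def[abs_def] ..

lemma additive_neg_lam_partial: "additive neg_lam_partial"
  by unfold_locales
     (simp add: neg_lam_partial_def additive.add[OF additive_map_poly[OF additive_partial]])

lemma additive_const: "additive (\<lambda>x. [:x:])"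
  by unfold_locales simp

lemma additive_skew: "additive (skew s)"
  unfolding skew_eq by (intro additive_poly_at additive_neg_lam_partial additive_const)

lemma skew_pCons_0: "skew s (pCons 0 q) = - pCons 0 (skew s q) - map_poly (partial s) (skew s q)"
  by (simp add: skew_eq poly_at_pCons additive_neg_lam_partial additive_const
        neg_lam_partial_def[of "poly_at _ _ _"])

lemma skew_map_poly:
  assumes g: "additive g" and "\<And>x. g (partial s x) = partial s (g x)"
  shows "skew s (map_poly g q) = map_poly g (skew s q)"
proof -
  interpret M: additive "map_poly g" using g by (rule additive_map_poly)
  have "map_poly g (skew s q) = poly_at neg_lam_partial (\<lambda>x. map_poly g [:x:]) q"
    unfolding skew_eq
    by (rule poly_at_intertwine)
       (simp_all add: M.additive_axioms M.diff M.minus neg_lam_partial_def map_poly_pCons additive.zero[OF g]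
         map_poly_commute[OF g additive_partial assms(2)])
  then show ?thesis
    by (simp add: skew_eq poly_at_map_poly additive_neg_lam_partial additive_const g map_poly_pCons additive.zero[OF g])
qed

lemma skew_partial: "skew s (map_poly (partial s) q) = map_poly (partial s) (skew s q)"
  by (rule skew_map_poly) (simp_all add: additive_partial)

lemma skew_const: "skew s [:x:] = [:x:]"
  by (simp add: skew_eq poly_at_const additive_const)

text \<open>
  The substitution \<open>\<nu> := - \<lambda> - \<partial>\<close> sends \<open>- \<lambda> - \<partial>\<close> back to \<open>- (- \<lambda> - \<partial>) - \<partial> = \<lambda>\<close>.
\<close>

lemma skew_skew: "skew s (skew s q) = q"
proof (induction q)
  case 0
  then show ?case by (simp add: additive.zero[OF additive_skew])
next
  case (pCons a q)
  have "pCons a q = [:a:] + pCons 0 q" by simp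
  then have "skew s (skew s (pCons a q)) = skew s (skew s [:a:]) + skew s (skew s (pCons 0 q))"
    by (metis additive.add[OF additive_skew])
  also have "\<dots> = [:a:] + pCons 0 q"
    by (simp add: skew_const skew_pCons_0 skew_partial additive.diff[OF additive_skew]
        additive.minus[OF additive_skew] additive.minus[OF additive_map_poly[OF additive_partial]]
        pCons.IH)
  finally show ?case by simp
qed

lemma at2_pCons_0: "additive X \<Longrightarrow> at2 X (pCons 0 q) = X (at2 X q)"
  by (simp add: at2_def poly_at_pCons additive_const2)

lemma at2_map_poly_partial:
  assumes "parameter s X"
  shows "at2 X (map_poly (partial s) q) = Partial2 s (at2 X q)"
  unfolding at2_def
  by (subst poly_at_intertwine[of "Partial2 s" X X])
     (simp_all add: additive_Partial2 parameter_commute[OF parameter.Partial2 assms]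
       poly_at_map_poly additive_parameter[OF assms] additive_const2 additive_partial,
      simp add: Partial2_def map_poly_pCons additive.zero[OF additive_partial])

text \<open>
  Substituting \<open>\<nu> := - \<lambda> - \<partial>\<close> and then \<open>\<lambda> := X\<close> amounts to \<open>\<nu> := - X - \<partial>\<close>, because \<open>\<partial>\<close> commutes
  with \<open>X\<close>.
\<close>

lemma at2_skew:
  assumes "parameter s X" and "\<And>w. X' w = - X w - Partial2 s w"
  shows "at2 X (skew s q) = at2 X' q"
proof -
  have X: "additive X" using assms(1) by (rule additive_parameter)
  interpret A: additive "at2 X" using X by (rule additive_at2)
  have c: "at2 X [:x:] = [:[:x:]:]" for x
    by (simp add: at2_def poly_at_const additive_const2)
  show ?thesis
    unfolding skew_eq
    by (subst poly_at_intertwine[of "at2 X" neg_lam_partial X'])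
       (simp_all add: A.additive_axioms A.diff A.minus neg_lam_partial_def at2_pCons_0
         at2_map_poly_partial X assms additive.minus[OF X] c flip: at2_def del: minus_pCons)
qed

lemma nested_at_skew_outer:
  assumes "parameter s X" and "\<And>w. X' w = - X w - Partial2 s w"
  shows "nested_at X (\<lambda>x. skew s (f x)) Y q = nested_at X' f Y q"
  by (simp add: nested_at_def at2_skew[OF assms])

text \<open>
  Here \<open>U\<close> is the operator on the result into which \<open>f\<^sub>X\<close> turns a \<open>\<partial>\<close> on its argument. The inner
  parameter \<open>- Y - \<partial>\<close> therefore becomes \<open>- Y - U\<close>. For conformal products \<open>U\<close> is \<open>- X\<close> or
  \<open>\<partial> + X\<close>, depending on the side, which gives \<open>nested_at_skew_left\<close> and
  \<open>nested_at_skew_right\<close>.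
\<close>

lemma nested_at_skew_inner:
  assumes X: "parameter s X" and Y: "parameter s Y" and f: "additive f"
    and U: "additive U" "\<And>w. U (Y w) = Y (U w)"
    and fU: "\<And>x. at2 X (f (partial s x)) = U (at2 X (f x))"
    and Y': "\<And>w. Y' w = - Y w - U w"
  shows "nested_at X f Y (skew s q) = nested_at X f Y' q"
proof -
  note X' = additive_parameter[OF X] and Y'' = additive_parameter[OF Y]
  have h: "additive (\<lambda>x. at2 X (f x))" 
    by (rule additive_comp[OF additive_at2[OF X'] f])
  interpret A: additive "nested_at X f Y" by (intro additive_nested_at X' Y'' f)
  have d: "nested_at X f Y (map_poly (partial s) q) = U (nested_at X f Y q)" for q
    unfolding nested_at_def
    by (simp add: poly_at_map_poly Y'' h additive_partial fU poly_at_intertwine[of U Y Y] U)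
  have p: "nested_at X f Y (pCons 0 q) = Y (nested_at X f Y q)" for q
    by (simp add: nested_at_def poly_at_pCons Y'' h additive.zero[OF h])
  have "nested_at X f Y (skew s q) = poly_at Y' (\<lambda>x. nested_at X f Y [:x:]) q"
    unfolding skew_eq
    by (rule poly_at_intertwine) (simp_all add: A.additive_axioms A.diff A.minus neg_lam_partial_def d p Y'
      additive.minus[OF Y''] del: minus_pCons)
  then show ?thesis by (simp add: nested_at_def poly_at_const h)
qed

lemma ext2_Partial2:
  assumes X: "additive X" and f: "additive f"
    and U: "additive U" "\<And>w. U (Lam w) = Lam (U w)" "\<And>w. U (Mu w) = Mu (U w)"
    and fU: "\<And>x. at2 X (f (partial s x)) = U (at2 X (f x))"
  shows "ext2 X f (Partial2 s w) = U (ext2 X f w)"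
proof -
  have h: "additive (\<lambda>x. at2 X (f x))"
    by (rule additive_comp[OF additive_at2[OF X] f])
  have A: "additive (poly_at Lam (\<lambda>x. at2 X (f x)))"
    by (intro additive_poly_at h additive_Lam)
  show ?thesis
    by (simp add: ext2_def Partial2_def poly_at_map_poly additive_Mu additive_Lam A h
        additive_map_poly additive_partial fU poly_at_intertwine[of U Mu Mu]
        poly_at_intertwine[of U Lam Lam] U)
qed

section \<open>Conformal products\<close>

lemma k_linear_skew:
  assumes "k_linear s s f"
  shows "k_linear s s (\<lambda>x. skew s (f x))"
proof -
  have c: "s [:c:] (partial s x) = partial s (s [:c:] x)" for c x
    by (simp add: partial_def mult.commute)
  show ?thesis
    using assms
    by (simp add: k_linear_def Vector_Spaces.linear_iff additive.add[OF additive_skew]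
        skew_map_poly[OF additive_scale c])
qed

lemma k_linear_add:
  assumes "k_linear s s f" "k_linear s s g"
  shows "k_linear s s (\<lambda>x. f x + g x)"
  using assms
  by (simp add: k_linear_def Vector_Spaces.linear_iff additive.add[OF additive_map_poly[OF additive_scale]])

lemma k_linear_uminus:
  assumes "k_linear s s f"
  shows "k_linear s s (\<lambda>x. - f x)"
  using assms
  by (simp add: k_linear_def Vector_Spaces.linear_iff additive.minus[OF additive_map_poly[OF additive_scale]])

end

context conformal_product
begin

lemma additive_left: "additive (\<lambda>a. m a b)"
  using linear_left by (simp add: k_linear_def Vector_Spaces.linear_iff additive_def)

lemma additive_right: "additive (m a)"
  using linear_right by (simp add: k_linear_def Vector_Spaces.linear_iff additive_def)

lemma at2_partial_left:
  "parameter s X \<Longrightarrow> at2 X (m (partial s a) b) = - X (at2 X (m a b))"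
  by (simp add: partial_left additive.minus[OF additive_at2] additive_parameter at2_pCons_0
      del: minus_pCons)

lemma at2_partial_right:
  "parameter s X \<Longrightarrow> at2 X (m a (partial s b)) = Partial2 s (at2 X (m a b)) + X (at2 X (m a b))"
  by (simp add: partial_right additive.add[OF additive_at2] additive_parameter at2_pCons_0
     at2_map_poly_partial)

text \<open>
  With \<open>X = \<lambda> + \<mu>\<close> and \<open>Y = \<lambda>\<close> this is the rule \<open>(b\<^sub>-\<^sub>\<lambda>\<^sub>-\<^sub>\<partial> a)\<^sub>\<lambda>\<^sub>+\<^sub>\<mu> c = (b\<^sub>\<mu> a)\<^sub>\<lambda>\<^sub>+\<^sub>\<mu> c\<close>: the two inner
  parameters always sum to the outer one.
\<close>

lemma nested_at_skew_left:
  assumes "parameter s X" "parameter s Y" "\<And>w. Y' w = X w - Y w"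
  shows "nested_at X (\<lambda>x. m x c) Y (skew s q) = nested_at X (\<lambda>x. m x c) Y' q"
  by (rule nested_at_skew_inner[where U = "\<lambda>w. - X w"])
     (simp_all add: assms additive_left additive_parameter parameter.uminus
       parameter_commute[OF assms(1,2)] additive.minus at2_partial_left)

text \<open>
  With \<open>X = \<lambda>\<close> and \<open>Y = \<mu>\<close> this is the rule \<open>a\<^sub>\<lambda>(c\<^sub>-\<^sub>\<mu>\<^sub>-\<^sub>\<partial> b) = a\<^sub>\<lambda>(c\<^sub>\<zeta> b)\<close>: the parameters of
  \<open>a, b, c\<close> always sum to \<open>- \<partial>\<close>.
\<close>

lemma nested_at_skew_right:
  assumes "parameter s X" "parameter s Y" "\<And>w. Y' w = - X w - Y w - Partial2 s w"
  shows "nested_at X (m a) Y (skew s q) = nested_at X (m a) Y' q"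
proof (rule nested_at_skew_inner[where U = "\<lambda>w. Partial2 s w + X w"])
  have p: "parameter s (\<lambda>w. Partial2 s w + X w)"
    by (intro parameter.intros assms)
  show "additive (\<lambda>w. Partial2 s w + X w)" by (rule additive_parameter[OF p])
  show "Partial2 s (Y w) + X (Y w) = Y (Partial2 s w + X w)" for w
    by (rule parameter_commute[OF p assms(2)])
  show "Y' w = - Y w - (Partial2 s w + X w)" for w
    by (simp add: assms(3))
qed (simp_all add: assms additive_right at2_partial_right)

lemma nested_at_skew_instances:
  shows "nested_at Lam (m a) Mu (skew s q) = nested_at Lam (m a) (NegLamMuPartial s) q"
    and "nested_at Mu (m a) Lam (skew s q) = nested_at Mu (m a) (NegLamMuPartial s) q"
    and "nested_at (NegLamMuPartial s) (m a) Lam (skew s q) = nested_at (NegLamMuPartial s) (m a) Mu q"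
    and "nested_at LamMu (\<lambda>x. m x c) Lam (skew s q) = nested_at LamMu (\<lambda>x. m x c) Mu q"
    and "nested_at (NegLamPartial s) (\<lambda>x. m x c) Mu (skew s q) =
      nested_at (NegLamPartial s) (\<lambda>x. m x c) (NegLamMuPartial s) q"
    and "nested_at (NegMuPartial s) (\<lambda>x. m x c) Lam (skew s q) =
      nested_at (NegMuPartial s) (\<lambda>x. m x c) (NegLamMuPartial s) q"
proof goal_cases
qed (rule nested_at_skew_right nested_at_skew_left;
     (rule parameters | simp add: parameter_defs))+

text \<open>
  The representation axioms substitute \<open>- \<lambda> - \<partial>\<close> directly rather than through \<open>skew\<close>; the rule is
  the same as for \<open>nested_at_skew_right\<close>.
\<close>

lemma ext2_at2_NegLamPartial:
  assumes X: "parameter s X" and Y: "\<And>w. Y w = - X w - Lam w - Partial2 s w"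
  shows "ext2 X (m a) (at2 (NegLamPartial s) q) = nested_at X (m a) Y q"
proof (rule ext2_at2)
  have p: "parameter s (\<lambda>w. Partial2 s w + X w)"
    by (intro parameter.intros X)
  fix w
  note A = additive_parameter[OF X] additive_right[of a]
  have "ext2 X (m a) (Partial2 s w) = Partial2 s (ext2 X (m a) w) + X (ext2 X (m a) w)"
    by (rule ext2_Partial2[where U = "\<lambda>w. Partial2 s w + X w"])
       (simp_all add: A additive_parameter[OF p] parameter_commute[OF p parameter.Lam]
         parameter_commute[OF p parameter.Mu] at2_partial_right X)
  then show "ext2 X (m a) (NegLamPartial s w) = Y (ext2 X (m a) w)"
    by (simp add: Y NegLamPartial_def additive.diff[OF additive_ext2[OF A]]
        additive.minus[OF additive_ext2[OF A]] ext2_Lam[OF A])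
qed (simp_all add: additive_parameter X additive_right)

text \<open>
  Passing to the opposite product exchanges the two sesquilinearity rules, because the substitution
  \<open>\<nu> := - \<lambda> - \<partial>\<close> exchanges multiplication by \<open>- \<nu>\<close> with \<open>\<lambda> + \<partial>\<close>. The commutator and the
  anticommutator are combinations of a product and its opposite.
\<close>

lemma conformal_product_opposite: "conformal_product s (\<lambda>a b. skew s (m b a))"
proof
  show "k_linear s s (\<lambda>a. skew s (m b a))" for b by (rule k_linear_skew[OF linear_right])
  show "k_linear s s (\<lambda>b. skew s (m b a))" for a by (rule k_linear_skew[OF linear_left])
  show "skew s (m b (partial s a)) = - pCons 0 (skew s (m b a))" for a b
    by (simp add: partial_right additive.add[OF additive_skew] skew_partial skew_pCons_0)
  show "skew s (m (partial s b) a) = map_poly (partial s) (skew s (m b a)) + pCons 0 (skew s (m b a))"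
    for a b
    by (simp add: partial_left additive.minus[OF additive_skew] skew_pCons_0 del: minus_pCons)
qed

lemma conformal_product_uminus: "conformal_product s (\<lambda>a b. - m a b)"
  by unfold_locales
     (simp_all add: k_linear_uminus linear_left linear_right partial_left partial_right
       additive.minus[OF additive_map_poly[OF additive_partial]])

lemma conformal_product_add:
  assumes "conformal_product s n"
  shows "conformal_product s (\<lambda>a b. m a b + n a b)"
proof -
  interpret n: conformal_product s n by fact
  show ?thesis
    by unfold_locales
      (simp_all add: k_linear_add linear_left linear_right partial_left partial_right
       n.linear_left n.linear_right n.partial_left n.partial_right
       additive.add[OF additive_map_poly[OF additive_partial]])
qed

lemma conformal_product_commutator: "conformal_product s (conformal_commutator s m)"
  using conformal_product_add[OF conformal_product.conformal_product_uminus[OF conformal_product_opposite]]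
  by (simp add: conformal_commutator_def[abs_def])

lemma conformal_product_anticommutator: "conformal_product s (conformal_anticommutator s m)"
  using conformal_product_add[OF conformal_product_opposite]
  by (simp add: conformal_anticommutator_def[abs_def])

text \<open>
  Skewing an outer product only changes its parameter from \<open>X\<close> to \<open>- X - \<partial>\<close>, the sum of the other
  parameters.
\<close>

lemma nested_at_commutator:
  assumes X: "parameter s X" and Y: "parameter s Y" and X': "\<And>w. X' w = - X w - Partial2 s w"
  shows "nested_at X (conformal_commutator s m a) Y q =
      nested_at X (m a) Y q - nested_at X' (\<lambda>b. m b a) Y q"
    and "nested_at X (\<lambda>a. conformal_commutator s m a b) Y q =
      nested_at X (\<lambda>a. m a b) Y q - nested_at X' (m b) Y q"
  unfolding conformal_commutator_def[abs_def]
  by (simp_all add: nested_at_diff additive_parameter X Y nested_at_skew_outer[OF X X'])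

lemma nested_at_anticommutator:
  assumes X: "parameter s X" and Y: "parameter s Y" and X': "\<And>w. X' w = - X w - Partial2 s w"
  shows "nested_at X (conformal_anticommutator s m a) Y q =
      nested_at X (m a) Y q + nested_at X' (\<lambda>b. m b a) Y q"
    and "nested_at X (\<lambda>a. conformal_anticommutator s m a b) Y q =
      nested_at X (\<lambda>a. m a b) Y q + nested_at X' (m b) Y q"
  unfolding conformal_anticommutator_def[abs_def]
  by (simp_all add: nested_at_add additive_parameter X Y nested_at_skew_outer[OF X X'])

lemma commutator_skew: "conformal_commutator s m a b = - skew s (conformal_commutator s m b a)"
  by (simp add: conformal_commutator_def additive.diff[OF additive_skew] skew_skew)

lemma anticommutator_skew: "conformal_anticommutator s m a b = skew s (conformal_anticommutator s m b a)"
  by (simp add: conformal_anticommutator_def additive.add[OF additive_skew] skew_skew)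

text \<open>
  Compatibility with a scalar \<open>p(\<partial>)\<close> follows from the cases of constants and of \<open>\<partial>\<close>, by
  induction on \<open>p\<close>.
\<close>

lemma gc_hom_left_mult: "gc_hom s s (left_mult m)"
proof -
  have A: "additive (\<lambda>c. map_poly (s [:c:]) q)" for q
  proof
    fix c d
    have "s [:c + d:] x = s [:c:] x + s [:d:] x" for x
      using scale_left_distrib[of "[:c:]" "[:d:]" x] by simp
    then show "map_poly (s [:c + d:]) q = map_poly (s [:c:]) q + map_poly (s [:d:]) q"
      by (simp add: poly_eq_iff coeff_map_poly)
  qed
  have "m (s p a) v = gc_scale s p (m a) v" for p a v
  proof (induction p)
    case 0
    show ?case
      by (simp add: gc_scale_def poly_at_0[OF A] additive.zero[OF additive_left])
  next
    case (pCons c p)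
    have N: "additive (\<lambda>w::'p poly. - pCons 0 w)"
      by unfold_locales simp
    have "s (pCons c p) a = s [:c:] a + partial s (s p a)"
      by (simp add: partial_def flip: scale_left_distrib)
    then show ?case
      using linear_left[of v] pCons.IH
      by (simp add: additive.add[OF additive_left] gc_scale_def poly_at_pCons A N partial_left
         k_linear_def Vector_Spaces.linear_iff del: minus_pCons)
  qed
  then show ?thesis
    by (simp add: gc_hom_def gc_def left_mult_def linear_right partial_right fun_eq_iff
        additive.add[OF additive_left] eta_contract_eq)
qed

end

section \<open>The axioms at arbitrary parameters\<close>

context fg_module
begin

lemma subst2_nested_at_parameter:
  assumes X: "parameter s X" and Y: "parameter s Y" and S: "\<And>w. S w = X w + Y w"
  shows "additive (subst2 X Y)"
    and "subst2 X Y (nested_at Lam f Mu q) = nested_at X f Y q"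
    and "subst2 X Y (nested_at Mu f Lam q) = nested_at Y f X q"
    and "subst2 X Y (nested_at LamMu f Lam q) = nested_at S f X q"
    and "subst2 X Y (nested_at LamMu f Mu q) = nested_at S f Y q"
proof -
  note E = subst2[OF additive_parameter[OF X] additive_parameter[OF Y] parameter_commute[OF X Y]]
  have L: "subst2 X Y (LamMu w) = S (subst2 X Y w)" for w
    by (simp add: LamMu_def additive.add[OF E(1)] E(2,3) S)
  note N = subst2_nested_at[of "subst2 X Y", OF E(1) E(4)]
  show "additive (subst2 X Y)" by (rule E(1))
  show "subst2 X Y (nested_at Lam f Mu q) = nested_at X f Y q"
    by (rule N[of Lam X Mu Y]) (rule E)+
  show "subst2 X Y (nested_at Mu f Lam q) = nested_at Y f X q"
    by (rule N[of Mu Y Lam X]) (rule E)+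
  show "subst2 X Y (nested_at LamMu f Lam q) = nested_at S f X q"
    by (rule N[of LamMu S Lam X]) (rule L E)+
  show "subst2 X Y (nested_at LamMu f Mu q) = nested_at S f Y q"
    by (rule N[of LamMu S Mu Y]) (rule L E)+
qed

end

text \<open>
  This and the three companion lemmas are oriented as rewrite rules that remove one
  product of the form \<open>a\<^sub>X(b\<^sub>Y c)\<close>.
\<close>

lemma (in left_symmetric_conformal_algebra) left_symmetric_at:
  assumes "parameter s X" "parameter s Y" "\<And>w. S w = X w + Y w"
  shows "nested_at X (m a) Y (m b c) =
    nested_at S (\<lambda>x. m x c) X (m a b) + nested_at Y (m b) X (m a c) - nested_at S (\<lambda>x. m x c) Y (m b a)"
proof -
  note E = subst2_nested_at_parameter[OF assms]
  note B = additive_parameter[OF parameters(1)] additive_parameter[OF parameters(2)]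
    additive_parameter[OF parameters(3)]
  have "nested_at Lam (m a) Mu (m b c) - nested_at LamMu (\<lambda>x. m x c) Lam (m a b) =
     nested_at Mu (m b) Lam (m a c) - nested_at LamMu (\<lambda>x. m x c) Mu (m b a)"
    using left_symmetric[of a b c]
    by (simp add: ext2_at2_Lam ext2_at2_Mu B additive_left additive_right)
  from arg_cong[OF this, of "subst2 X Y"] show ?thesis
    by (simp add: additive.diff[OF E(1)] E(2-5) algebra_simps)
qed

text \<open>
  The skewed term \<open>b\<^sub>-\<^sub>\<lambda>\<^sub>-\<^sub>\<partial> a\<close> in the axiom becomes \<open>b\<^sub>\<mu> a\<close> under the product at \<open>\<lambda> + \<mu>\<close>. Only
  after the \<open>\<partial>\<close> is gone may other parameters be substituted.
\<close>

lemma (in zinbiel_conformal_algebra) zinbiel_at: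
  assumes "parameter s X" "parameter s Y" "\<And>w. S w = X w + Y w"
  shows "nested_at X (m a) Y (m b c) =
    nested_at S (\<lambda>x. m x c) X (m a b) + nested_at S (\<lambda>x. m x c) Y (m b a)"
proof -
  note E = subst2_nested_at_parameter[OF assms]
  note B = additive_parameter[OF parameters(1)] additive_parameter[OF parameters(2)]
    additive_parameter[OF parameters(3)]
  have "nested_at Lam (m a) Mu (m b c) =
     nested_at LamMu (\<lambda>x. m x c) Lam (m a b) + nested_at LamMu (\<lambda>x. m x c) Mu (m b a)"
    using zinbiel[of a b c]
    by (simp add: ext2_at2_Lam ext2_at2_Mu B additive_left additive_right
        additive.add[OF additive_nested_at]
        nested_at_skew_left[OF parameters(3,1), where Y' = Mu] LamMu_def)
  from arg_cong[OF this, of "subst2 X Y"] show ?thesis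
    by (simp add: additive.add[OF E(1)] E(2-5) algebra_simps)
qed

context pre_poisson_conformal_algebra
begin

lemma conformal_product_circ: "conformal_product s circ"
  by (rule left_symmetric_conformal_algebra.axioms(1)[OF left_symmetric_conformal_algebra_axioms])

lemma conformal_product_succ: "conformal_product s succ"
  by (rule zinbiel_conformal_algebra.axioms(1)[OF zinbiel_conformal_algebra_axioms])

lemmas additive_products =
  conformal_product.additive_left[OF conformal_product_circ]
  conformal_product.additive_right[OF conformal_product_circ]
  conformal_product.additive_left[OF conformal_product_succ]
  conformal_product.additive_right[OF conformal_product_succ]

lemma circ_succ_at:
  assumes "parameter s X" "parameter s Y" "\<And>w. S w = X w + Y w"
  shows "nested_at X (circ a) Y (succ b c) =
    nested_at S (\<lambda>x. succ x c) X (circ a b) - nested_at S (\<lambda>x. succ x c) Y (circ b a) +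
    nested_at Y (succ b) X (circ a c)"
proof -
  note E = subst2_nested_at_parameter[OF assms]
  note B = additive_parameter[OF parameters(1)] additive_parameter[OF parameters(2)]
    additive_parameter[OF parameters(3)]
  have "nested_at LamMu (\<lambda>x. succ x c) Lam (circ a b) - nested_at LamMu (\<lambda>x. succ x c) Mu (circ b a)
    = nested_at Lam (circ a) Mu (succ b c) - nested_at Mu (succ b) Lam (circ a c)"
    using circ_succ[of c a b]
    by (simp add: ext2_at2_Lam ext2_at2_Mu B additive_products
        additive.diff[OF additive_nested_at]
        conformal_product.nested_at_skew_left[OF conformal_product_succ parameters(3,1), where Y' = Mu] 
        LamMu_def)
  from arg_cong[OF this, of "subst2 X Y"] show ?thesis
    by (simp add: additive.diff[OF E(1)] E(2-5) algebra_simps)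
qed

lemma succ_circ_at:
  assumes "parameter s X" "parameter s Y" "\<And>w. S w = X w + Y w"
  shows "nested_at X (succ a) Y (circ b c) =
    nested_at S (\<lambda>x. circ x c) X (succ a b) + nested_at S (\<lambda>x. circ x c) Y (succ b a) -
    nested_at Y (succ b) X (circ a c)"
proof -
  note E = subst2_nested_at_parameter[OF assms]
  note B = additive_parameter[OF parameters(1)] additive_parameter[OF parameters(2)]
    additive_parameter[OF parameters(3)]
  have "nested_at LamMu (\<lambda>x. circ x c) Lam (succ a b) + nested_at LamMu (\<lambda>x. circ x c) Mu (succ b a)
    = nested_at Lam (succ a) Mu (circ b c) + nested_at Mu (succ b) Lam (circ a c)"
    using succ_circ[of c a b]
    by (simp add: ext2_at2_Lam ext2_at2_Mu B additive_products
        additive.add[OF additive_nested_at]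
        conformal_product.nested_at_skew_left[OF conformal_product_circ parameters(3,1), where Y' = Mu] 
        LamMu_def)
  from arg_cong[OF this, of "subst2 X Y"] show ?thesis
    by (simp add: additive.add[OF E(1)] E(2-5) algebra_simps)
qed

section \<open>The associated Poisson conformal algebra\<close>

abbreviation "\<zeta> \<equiv> NegLamMuPartial s"

abbreviation "br \<equiv> conformal_commutator s circ"
abbreviation "pr \<equiv> conformal_anticommutator s succ"

lemmas conformal_product_br = conformal_product.conformal_product_commutator[OF conformal_product_circ]
lemmas conformal_product_pr = conformal_product.conformal_product_anticommutator[OF conformal_product_succ]

lemmas additive_br_pr =
  conformal_product.additive_left[OF conformal_product_br]
  conformal_product.additive_right[OF conformal_product_br]
  conformal_product.additive_left[OF conformal_product_pr]
  conformal_product.additive_right[OF conformal_product_pr]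

lemmas additive_parameters = parameters[THEN additive_parameter]

lemmas ext2_nested =
  ext2_at2_Lam ext2_at2_Mu additive_products additive_br_pr additive_parameters

text \<open>
  The parameters \<open>\<lambda>\<close>, \<open>\<mu>\<close>, \<open>\<lambda> + \<mu>\<close> and their skew counterparts \<open>\<mu> + \<zeta>\<close>, \<open>\<lambda> + \<zeta>\<close>, \<open>\<zeta>\<close>.
\<close>

lemma complement:
  "NegLamPartial s w = - Lam w - Partial2 s w"
  "NegMuPartial s w = - Mu w - Partial2 s w"
  "\<zeta> w = - LamMu w - Partial2 s w"
  by (simp_all add: parameter_defs)

lemmas outer_br =
  conformal_product.nested_at_commutator[OF conformal_product_circ parameters(1) _ complement(1)]
  conformal_product.nested_at_commutator[OF conformal_product_circ parameters(2) _ complement(2)]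
  conformal_product.nested_at_commutator[OF conformal_product_circ parameters(3) _ complement(3)]

lemmas outer_pr =
  conformal_product.nested_at_anticommutator[OF conformal_product_succ parameters(1) _ complement(1)]
  conformal_product.nested_at_anticommutator[OF conformal_product_succ parameters(2) _ complement(2)]
  conformal_product.nested_at_anticommutator[OF conformal_product_succ parameters(3) _ complement(3)]

lemmas inner_skews =
  conformal_product.nested_at_skew_instances[OF conformal_product_circ]
  conformal_product.nested_at_skew_instances[OF conformal_product_succ]

lemma sums:
  "LamMu w = Lam w + Mu w" "LamMu w = Mu w + Lam w"
  "NegMuPartial s w = Lam w + \<zeta> w" "NegMuPartial s w = \<zeta> w + Lam w"
  "NegLamPartial s w = Mu w + \<zeta> w" "NegLamPartial s w = \<zeta> w + Mu w"
  by (simp_all add: parameter_defs)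

text \<open>
  Left symmetry exchanges the roles of \<open>(X, a)\<close> and \<open>(Y, b)\<close>, so as a rewrite rule it would loop if
  both orders of a pair were included. The mixed axioms are included only at the pairs that
  occur, for the same reason: each of them produces a product that the other one could rewrite.
\<close>

lemmas left_symmetric_instances =
  left_symmetric_at[OF parameters(1,2) sums(1)]
  left_symmetric_at[OF parameters(1,6) sums(3)]
  left_symmetric_at[OF parameters(2,6) sums(5)]

text \<open>
  The Zinbiel rule yields only products of the form \<open>(a\<^sub>X b)\<^sub>X\<^sub>+\<^sub>Y c\<close>, so all six orders may be used
  together; they reduce both sides of an identity to products of this form.
\<close>

lemmas zinbiel_instances =
  zinbiel_at[OF parameters(1,2) sums(1)]
  zinbiel_at[OF parameters(2,1) sums(2)]
  zinbiel_at[OF parameters(1,6) sums(3)]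
  zinbiel_at[OF parameters(6,1) sums(4)]
  zinbiel_at[OF parameters(2,6) sums(5)]
  zinbiel_at[OF parameters(6,2) sums(6)]

lemmas circ_succ_instances =
  circ_succ_at[OF parameters(1,2) sums(1)]
  circ_succ_at[OF parameters(1,6) sums(3)]

lemmas succ_circ_instances =
  succ_circ_at[OF parameters(2,6) sums(5)]

lemmas inner_br_pr =
  conformal_commutator_def conformal_anticommutator_def
  additive.add[OF additive_nested_at] additive.diff[OF additive_nested_at]
  additive_parameters additive_products inner_skews

text \<open>
  In each identity the outer operations are opened first, while the inner ones are still known to be
  conformal products. The inner ones are then opened, and what remains are sums of nested
  \<open>\<circ>\<close>- and \<open>\<succ>\<close>-products at parameters among \<open>\<lambda>, \<mu>, \<zeta>\<close>. The Leibniz rule needs the first mixed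
  axiom at \<open>(\<lambda>, \<mu>)\<close> and \<open>(\<lambda>, \<zeta>)\<close> and the second one at \<open>(\<mu>, \<zeta>)\<close>.
\<close>

lemma poisson_commutator_anticommutator: "poisson_conformal_algebra s br pr"
proof -
  interpret br: conformal_product s br by (rule conformal_product_br)
  interpret pr: conformal_product s pr by (rule conformal_product_pr)
  show ?thesis
  proof
    show "br a b = - skew s (br b a)" for a b
      by (rule conformal_product.commutator_skew[OF conformal_product_circ])
    show "pr a b = skew s (pr b a)" for a b
      by (rule conformal_product.anticommutator_skew[OF conformal_product_succ])
  next
    fix a b c
    show "ext2 Lam (br a) (at2 Mu (br b c)) =
      ext2 LamMu (\<lambda>x. br x c) (at2 Lam (br a b)) + ext2 Mu (br b) (at2 Lam (br a c))"
      by (simp only: ext2_nested outer_br parameters)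
         (simp add: inner_br_pr left_symmetric_instances algebra_simps)
    show "ext2 LamMu (\<lambda>x. pr x c) (at2 Lam (pr a b)) = ext2 Lam (pr a) (at2 Mu (pr b c))"
      by (simp only: ext2_nested outer_pr parameters)
         (simp add: inner_br_pr zinbiel_instances algebra_simps)
    show "ext2 Lam (br a) (at2 Mu (pr b c)) =
     ext2 LamMu (\<lambda>x. pr x c) (at2 Lam (br a b)) + ext2 Mu (pr b) (at2 Lam (br a c))"
      by (simp only: ext2_nested outer_br outer_pr parameters)
         (simp add: inner_br_pr circ_succ_instances succ_circ_instances algebra_simps)
  qed
qed

text \<open>
  Three of the four identities restate an axiom with the commutator or anticommutator as inner
  product. The fourth, for \<open>\<rho>(a\<^sub>\<mu> b)\<close>, is the second mixed axiom at \<open>(\<mu>, \<zeta>)\<close>.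
\<close>

lemma representation_left_mult:
  "poisson_conformal_representation s br pr s (left_mult circ) (left_mult succ)"
proof -
  interpret poisson_conformal_algebra s br pr by (rule poisson_commutator_anticommutator)
  show ?thesis
  proof
    show "gc_hom s s (left_mult circ)"
      by (rule conformal_product.gc_hom_left_mult[OF conformal_product_circ])
    show "gc_hom s s (left_mult succ)"
      by (rule conformal_product.gc_hom_left_mult[OF conformal_product_succ])
  next
    fix a b v
    show "ext2 LamMu (\<lambda>x. left_mult circ x v) (at2 Lam (br a b)) =
     ext2 Lam (left_mult circ a) (at2 Mu (left_mult circ b v)) -
     ext2 Mu (left_mult circ b) (at2 Lam (left_mult circ a v))"
      by (simp add: left_mult_def ext2_nested)
         (simp add: inner_br_pr left_symmetric_instances algebra_simps)
    show "ext2 LamMu (\<lambda>x. left_mult succ x v) (at2 Lam (pr a b)) =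
     ext2 Lam (left_mult succ a) (at2 Mu (left_mult succ b v))"
      by (simp add: left_mult_def ext2_nested)
         (simp add: inner_br_pr zinbiel_instances algebra_simps)
    show "ext2 Lam (left_mult circ a) (at2 Mu (left_mult succ b v)) =
     ext2 LamMu (\<lambda>x. left_mult succ x v) (at2 Lam (br a b)) +
     ext2 Mu (left_mult succ b) (at2 Lam (left_mult circ a v))"
      by (simp add: left_mult_def ext2_nested)
         (simp add: inner_br_pr circ_succ_instances algebra_simps)
    (* zeta and mu are each minus the sum of the other one, lambda and the derivation *)
    have M: "Mu w = - \<zeta> w - Lam w - Partial2 s w" "\<zeta> w = - Mu w - Lam w - Partial2 s w" for w
      by (simp_all add: parameter_defs)
    note N = conformal_product.ext2_at2_NegLamPartial[OF conformal_product_succ parameters(6) M(1)]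
      conformal_product.ext2_at2_NegLamPartial[OF conformal_product_succ parameters(2) M(2)]
    show "ext2 (NegLamPartial s) (\<lambda>x. left_mult circ x v) (at2 Mu (pr a b)) =
     ext2 (NegLamMuPartial s) (left_mult succ b) (at2 (NegLamPartial s) (left_mult circ a v)) +
     ext2 Mu (left_mult succ a) (at2 (NegLamPartial s) (left_mult circ b v))"
      by (simp add: left_mult_def N ext2_nested)
         (simp add: inner_br_pr succ_circ_instances algebra_simps)
  qed
qed

lemma O_operator_id:
  "O_operator s br pr s (left_mult circ) (left_mult succ) id"
proof -
  interpret poisson_conformal_representation s br pr s "left_mult circ" "left_mult succ"
    by (rule representation_left_mult)
  show ?thesis
    by unfold_locales
       (simp_all add: left_mult_def conformal_commutator_def conformal_anticommutator_def)
qed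

end

theorem proposition3p18:
  fixes s :: "'k::field_char_0 poly \<Rightarrow> 'p::ab_group_add \<Rightarrow> 'p"
    and circ succ :: "'p \<Rightarrow> 'p \<Rightarrow> 'p poly"
  assumes "pre_poisson_conformal_algebra s circ succ"
  shows "poisson_conformal_algebra s
           (conformal_commutator s circ) (conformal_anticommutator s succ) \<and>
         poisson_conformal_representation s
           (conformal_commutator s circ) (conformal_anticommutator s succ)
           s (left_mult circ) (left_mult succ) \<and>
         O_operator s
           (conformal_commutator s circ) (conformal_anticommutator s succ)
           s (left_mult circ) (left_mult succ) id"
  by (intro conjI pre_poisson_conformal_algebra.poisson_commutator_anticommutator
      pre_poisson_conformal_algebra.representation_left_mult
      pre_poisson_conformal_algebra.O_operator_id assms)

end
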